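(* Let $F$ be a quasi-convex function. Then, for function spaces over $(0,\infty)$ with Lebesgue measure, $$M^F=\bigcap\{L^B: B\text{ is a Young function such that } M^F\hookrightarrow L^B\}.$$
   Context: A function $A:[0,\infty]\to[0,\infty]$ is quasi-convex if it is left-continuous, not identically zero or infinity on $(0,\infty]$, $A(0)=0$, and $t\mapsto A(t)/t$ is non-decreasing on $(0,\infty)$; it is a Young function if moreover it is convex. For measurable $f:(0,\infty)\to[-\infty,\infty]$, $f_*(\lambda)=|\{|f|>\lambda\}|$, $f^*(t)=\inf\{\lambda\ge0:f_*(\lambda)\le t\}$ and $f^{**}(t)=\frac1t\int_0^tf^*$. For quasi-convex $A$: - $\|f\|_{L^A}=\inf\{\lambda>0:\int_0^\infty A(|f|/\lambda)\le1\}$ and $L^A=\{f:\|f\|_{L^A}<\infty\}$ (Orlicz space); - $A^{-1}(t)=\sup\{\tau\ge0:A(\tau)\le t\}$ is the right-continuous inverse, $A^{-1}_\#(t)=1/A^{-1}(1/t)$ (with $1/0=\infty$, $1/\infty=0$), $\|f\|_{M^A}=\sup_{t\in(0,\infty)}A^{-1}_\#(t)f^{**}(t)$ and $M^A=\{f:\|f\|_{M^A}<\infty\}$ (weak Orlicz, or Marcinkiewicz, space). $X\hookrightarrow Y$ means that there is $C>0$ with $\|f\|_Y\le C\|f\|_X$ for every $f\in X$. *)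

theory Defs
  imports "HOL-Analysis.Analysis"
begin

(* Left-continuity is required at every point of [0,\<infinity>], in particular at \<infinity>
   (it is void at 0, where the left filter is trivial). *)
definition quasi_convex :: "(ennreal \<Rightarrow> ennreal) \<Rightarrow> bool" where
  "quasi_convex A \<longleftrightarrow>
     (\<forall>t. (A \<longlongrightarrow> A t) (at_left t)) \<and>
     \<not> (\<forall>t>0. A t = 0) \<and> \<not> (\<forall>t>0. A t = \<infinity>) \<and>
     A 0 = 0 \<and>
     mono_on {0<..<\<infinity>} (\<lambda>t. A t / t)"

(* The weights u, v are elements of [0,1] because u + v = 1 in ennreal. *)
definition young_function :: "(ennreal \<Rightarrow> ennreal) \<Rightarrow> bool" where
  "young_function A \<longleftrightarrow> quasi_convex A \<and>
     (\<forall>s t u v. u + v = 1 \<longrightarrow> A (u * s + v * t) \<le> u * A s + v * A t)"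

(* Functions (0,\<infinity>) \<rightarrow> [-\<infinity>,\<infinity>] are represented by real \<Rightarrow> ereal;
   all notions below depend only on their values on {0<..}. *)
abbreviation half_line :: "real measure" where
  "half_line \<equiv> lebesgue_on {0<..}"

definition modulus :: "(real \<Rightarrow> ereal) \<Rightarrow> real \<Rightarrow> ennreal" where
  "modulus f x = e2ennreal \<bar>f x\<bar>"

definition distr_fun :: "(real \<Rightarrow> ereal) \<Rightarrow> ennreal \<Rightarrow> ennreal" where
  "distr_fun f l = emeasure half_line {x \<in> {0<..}. modulus f x > l}"

(* The level \<infinity> always satisfies the condition but does not change the infimum,
   since the infimum of the empty set is \<infinity>. *)
definition rearrangement :: "(real \<Rightarrow> ereal) \<Rightarrow> real \<Rightarrow> ennreal" where
  "rearrangement f t = Inf {l. distr_fun f l \<le> ennreal t}"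

definition maximal_rearrangement :: "(real \<Rightarrow> ereal) \<Rightarrow> real \<Rightarrow> ennreal" where
  "maximal_rearrangement f t =
     1 / ennreal t * (\<integral>\<^sup>+ s. rearrangement f s \<partial>lebesgue_on {0<..<t})"

definition orlicz_norm :: "(ennreal \<Rightarrow> ennreal) \<Rightarrow> (real \<Rightarrow> ereal) \<Rightarrow> ennreal" where
  "orlicz_norm A f =
     Inf {l. 0 < l \<and> l < \<infinity> \<and> (\<integral>\<^sup>+ x. A (modulus f x / l) \<partial>half_line) \<le> 1}"

definition right_inverse :: "(ennreal \<Rightarrow> ennreal) \<Rightarrow> ennreal \<Rightarrow> ennreal" where
  "right_inverse A t = Sup {\<tau>. A \<tau> \<le> t}"

definition sharp_inverse :: "(ennreal \<Rightarrow> ennreal) \<Rightarrow> ennreal \<Rightarrow> ennreal" where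
  "sharp_inverse A t = 1 / right_inverse A (1 / t)"

definition weak_orlicz_norm :: "(ennreal \<Rightarrow> ennreal) \<Rightarrow> (real \<Rightarrow> ereal) \<Rightarrow> ennreal" where
  "weak_orlicz_norm A f =
     (SUP t\<in>{0<..}. sharp_inverse A (ennreal t) * maximal_rearrangement f t)"

definition finite_norm_space :: "((real \<Rightarrow> ereal) \<Rightarrow> ennreal) \<Rightarrow> (real \<Rightarrow> ereal) set" where
  "finite_norm_space N = {f \<in> borel_measurable half_line. N f < \<infinity>}"

definition orlicz_space :: "(ennreal \<Rightarrow> ennreal) \<Rightarrow> (real \<Rightarrow> ereal) set" where
  "orlicz_space A = finite_norm_space (orlicz_norm A)"

definition weak_orlicz_space :: "(ennreal \<Rightarrow> ennreal) \<Rightarrow> (real \<Rightarrow> ereal) set" where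
  "weak_orlicz_space A = finite_norm_space (weak_orlicz_norm A)"

definition norm_embeds ::
  "((real \<Rightarrow> ereal) \<Rightarrow> ennreal) \<Rightarrow> ((real \<Rightarrow> ereal) \<Rightarrow> ennreal) \<Rightarrow> bool" where
  "norm_embeds N N' \<longleftrightarrow>
     (\<exists>C::real. 0 < C \<and> (\<forall>f\<in>finite_norm_space N. N' f \<le> ennreal C * N f))"

end

theory Submission
  imports Defs
begin

text \<open>
  If the weak Orlicz space of \<open>F\<close> embeds into an Orlicz space, it is contained in it, so one
  inclusion is immediate. For the other, given a measurable \<open>f\<close> with infinite weak norm, a Young
  function \<open>B\<close> is needed whose Orlicz space contains the weak space continuously but omits \<open>f\<close>.

  Put \<open>a t = right_inverse F (1 / t)\<close>, so that the weak norm is the supremum over \<open>t\<close> of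
  \<open>f\<^sup>*\<^sup>* t / a t\<close>. If \<open>g\<close> lies in the unit ball, then its rearrangement has integral
  at most \<open>t * a t\<close> over \<open>(0, t)\<close>, and hence the truncation of \<open>\<bar>g\<bar>\<close> at \<open>a t\<close>, that is
  \<open>\<bar>g\<bar> - a t\<close> where positive, has integral at most \<open>t * a t\<close> as well
  (\<open>nn_integral_modulus_diff_le\<close>). In other words, for each single \<open>t\<close>, the hinge function
  that maps \<open>x\<close> to the positive part of \<open>(x - a t) / (t * a t)\<close> has integral at most \<open>1\<close> along \<open>\<bar>g\<bar>\<close>.
  Averaging countably many hinges at points \<open>t = \<tau> k\<close> with the weights \<open>2 ^ - (k + 1)\<close> gives
  a convex function \<open>B\<close> into whose Orlicz space the weak space embeds with constant \<open>1\<close>,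
  regardless of the choice of \<open>\<tau>\<close> (\<open>norm_embeds_hinge_sum\<close>). Quasi-convexity enters in showing
  that the points \<open>a t\<close> are positive and finite and that \<open>B\<close> is finite at some positive point
  (\<open>hinge_sum_le_one\<close>).

  Conversely, the rearrangement of \<open>f\<close> has integral over \<open>(0, t)\<close> at most \<open>t * u\<close> plus the
  integral of the truncation of \<open>\<bar>f\<bar>\<close> at \<open>u\<close> (\<open>nn_integral_rearrangement_le\<close>). Thus if \<open>f\<close> is in the
  Orlicz space of \<open>B\<close>, the \<open>k\<close>-th hinge alone bounds \<open>f\<^sup>*\<^sup>* (\<tau> k) / a (\<tau> k)\<close> by a constant
  multiple of \<open>1 + 2 ^ (k + 1)\<close> (\<open>maximal_rearrangement_bound_of_orlicz\<close>). When the weak norm is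
  infinite, the points \<open>\<tau> k\<close> can be chosen so that these quotients exceed \<open>k * (1 + 2 ^ (k + 1))\<close>,
  and \<open>f\<close> is not in that Orlicz space. Functions that are not measurable are excluded by any
  single \<open>B\<close> of this form.
\<close>

section \<open>The layer-cake formula\<close>

lemma emeasure_lborel_Ioi: "emeasure lborel {u::real<..} = \<infinity>"
proof (rule ccontr)
  assume "\<not> ?thesis"
  then obtain r where "r \<ge> 0" and r: "emeasure lborel {u<..} = ennreal r"
    by (cases "emeasure lborel {u<..}") auto
  have "emeasure lborel {u<..<u + (r + 1)} \<le> emeasure lborel {u<..}"
    by (intro emeasure_mono) auto
  with r \<open>r \<ge> 0\<close> show False by (simp flip: ennreal_plus)
qed

text \<open>
  Truncating below at the level \<open>u\<close> keeps exactly the layers above \<open>u\<close>, because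
  \<open>h x - u\<close> is the length of the interval of levels between \<open>u\<close> and \<open>h x\<close>; the rest is Fubini.
  The truncated form makes both a function and its rearrangement computable from the same
  distribution function, with no translation of the level variable.
\<close>

lemma nn_integral_diff_layer_cake:
  fixes h :: "'a \<Rightarrow> ennreal"
  assumes "sigma_finite_measure M" and [measurable]: "h \<in> borel_measurable M" and "0 \<le> u"
  shows "(\<integral>\<^sup>+ x. h x - ennreal u \<partial>M) =
    (\<integral>\<^sup>+ l. indicator {u<..} l * emeasure M {x \<in> space M. ennreal l < h x} \<partial>lborel)"
proof -
  interpret M: sigma_finite_measure M by fact
  interpret pair_sigma_finite M lborel ..
  have slice: "y - ennreal u = (\<integral>\<^sup>+ l. indicator {u<..} l * indicator {l. ennreal l < y} l \<partial>lborel)"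
    for y :: ennreal
  proof -
    have "(\<integral>\<^sup>+ l. indicator {u<..} l * indicator {l. ennreal l < y} l \<partial>lborel)
      = (\<integral>\<^sup>+ l. indicator {l. u < l \<and> ennreal l < y} l \<partial>lborel)"
      by (intro nn_integral_cong) (auto split: split_indicator)
    also have "\<dots> = emeasure lborel {l. u < l \<and> ennreal l < y}"
      by (subst nn_integral_indicator) auto
    also have "\<dots> = y - ennreal u"
    proof (cases y)
      case (real r)
      then have "{l. u < l \<and> ennreal l < y} = {u<..<r}"
        using \<open>0 \<le> u\<close> by (auto simp: ennreal_less_iff)
      moreover have "emeasure lborel {u<..<r} = y - ennreal u"
        using real \<open>0 \<le> u\<close> by (cases "u \<le> r") (simp_all add: ennreal_minus_if)
      ultimately show ?thesis by simp
    next
      case top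
      then have "{l. u < l \<and> ennreal l < y} = {u<..}" by auto
      with top show ?thesis by (simp add: emeasure_lborel_Ioi)
    qed
    finally show ?thesis ..
  qed
  have "(\<integral>\<^sup>+ x. h x - ennreal u \<partial>M) =
    (\<integral>\<^sup>+ x. \<integral>\<^sup>+ l. indicator {u<..} l * indicator {l. ennreal l < h x} l \<partial>lborel \<partial>M)"
    by (simp only: slice)
  also have "\<dots> = (\<integral>\<^sup>+ l. \<integral>\<^sup>+ x. indicator {u<..} l * indicator {l. ennreal l < h x} l \<partial>M \<partial>lborel)"
    by (rule Fubini'[symmetric]) measurable
  also have "\<dots> = (\<integral>\<^sup>+ l. indicator {u<..} l * emeasure M {x \<in> space M. ennreal l < h x} \<partial>lborel)"
  proof (intro nn_integral_cong)
    fix l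
    have "(\<integral>\<^sup>+ x. indicator {u<..} l * indicator {l. ennreal l < h x} l \<partial>M)
      = (\<integral>\<^sup>+ x. indicator {u<..} l * indicator {x \<in> space M. ennreal l < h x} x \<partial>M)"
      by (intro nn_integral_cong) (auto split: split_indicator)
    also have "\<dots> = indicator {u<..} l * emeasure M {x \<in> space M. ennreal l < h x}"
      by (subst nn_integral_cmult) auto
    finally show "(\<integral>\<^sup>+ x. indicator {u<..} l * indicator {l. ennreal l < h x} l \<partial>M)
      = indicator {u<..} l * emeasure M {x \<in> space M. ennreal l < h x}" .
  qed
  finally show ?thesis .
qed

lemma sigma_finite_lebesgue_on:
  "S \<in> sets lebesgue \<Longrightarrow> sigma_finite_measure (lebesgue_on S :: 'a::euclidean_space measure)"
proof (rule sigma_finite_measure_restrict_space)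
  show "sigma_finite_measure (lebesgue :: 'a measure)"
  proof
    obtain A where A: "countable A" "A \<subseteq> sets (lborel :: 'a measure)" "\<Union>A = space (lborel :: 'a measure)"
        "\<forall>a\<in>A. emeasure lborel a \<noteq> \<infinity>"
      using lborel.sigma_finite_countable by blast
    then have "A \<subseteq> sets lebesgue" "\<forall>a\<in>A. emeasure lebesgue a \<noteq> \<infinity>"
      by (auto simp: subset_eq)
    with A show "\<exists>A. countable A \<and> A \<subseteq> sets (lebesgue :: 'a measure) \<and> \<Union>A = space lebesgue \<and>
        (\<forall>a\<in>A. emeasure lebesgue a \<noteq> \<infinity>)"
      by (intro exI[of _ A]) simp
  qed
qed simp

section \<open>Distribution functions and rearrangements\<close>

lemma borel_measurable_modulus [measurable (raw)]:
  "f \<in> borel_measurable M \<Longrightarrow> modulus f \<in> borel_measurable M"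
  unfolding modulus_def[abs_def] by measurable

lemma superlevel_set_measurable:
  assumes f: "f \<in> borel_measurable half_line"
  shows "{x \<in> {0<..}. l < modulus f x} \<in> sets half_line"
proof -
  have "{x \<in> space half_line. l < modulus f x} \<in> sets half_line"
    using borel_measurable_modulus[OF f] by measurable
  then show ?thesis by simp
qed

lemma distr_fun_antimono:
  assumes f: "f \<in> borel_measurable half_line" and "l \<le> l'"
  shows "distr_fun f l' \<le> distr_fun f l"
  unfolding distr_fun_def
  by (rule emeasure_mono) (use \<open>l \<le> l'\<close> superlevel_set_measurable[OF f, of l] in auto)

text \<open>
  Right-continuity, in the form used below: the superlevel set at \<open>l\<close> is the increasing union
  of the superlevel sets at the levels \<open>l + 1 / n\<close>.
\<close>

lemma distr_fun_right_continuous: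
  assumes f: "f \<in> borel_measurable half_line" and s: "s < distr_fun f l"
  shows "\<exists>l'>l. s < distr_fun f l'"
proof -
  have "l \<noteq> top" using s by (auto simp: distr_fun_def)
  then obtain r where "0 \<le> r" and l: "l = ennreal r" by (cases l) auto
  define E where "E n = {x \<in> {0<..}. ennreal (r + inverse (real (Suc n))) < modulus f x}" for n
  have "incseq E"
  proof (rule incseq_SucI)
    fix n
    have "ennreal (r + inverse (real (Suc (Suc n)))) \<le> ennreal (r + inverse (real (Suc n)))"
      by (intro ennreal_leI add_left_mono le_imp_inverse_le) auto
    then show "E n \<subseteq> E (Suc n)"
      unfolding E_def by auto
  qed
  moreover have "(\<Union>n. E n) = {x \<in> {0<..}. l < modulus f x}"
  proof (intro equalityI subsetI)
    fix x assume "x \<in> (\<Union>n. E n)"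
    moreover have "l \<le> ennreal (r + inverse (real (Suc n)))" for n
      unfolding l by (intro ennreal_leI) auto
    ultimately show "x \<in> {x \<in> {0<..}. l < modulus f x}"
      unfolding E_def by (auto dest: order_le_less_trans)
  next
    fix x assume x: "x \<in> {x \<in> {0<..}. l < modulus f x}"
    have "\<exists>n. ennreal (r + inverse (real (Suc n))) < modulus f x"
    proof (cases "modulus f x")
      case (real q)
      with x l \<open>0 \<le> r\<close> have "0 < q - r" by (auto simp: ennreal_less_iff)
      then obtain n where "inverse (real (Suc n)) < q - r"
        using reals_Archimedean by blast
      with real \<open>0 \<le> r\<close> show ?thesis by (intro exI[of _ n]) (auto simp: ennreal_less_iff simp del: ennreal_plus of_nat_Suc)
    qed auto
    with x show "x \<in> (\<Union>n. E n)" unfolding E_def by auto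
  qed
  ultimately have "distr_fun f l = (SUP n. emeasure half_line (E n))"
    unfolding distr_fun_def using superlevel_set_measurable[OF f]
    by (subst SUP_emeasure_incseq) (auto simp: E_def)
  with s obtain n where "s < emeasure half_line (E n)"
    by (auto simp: less_SUP_iff)
  moreover have "l < ennreal (r + inverse (real (Suc n)))"
    using \<open>0 \<le> r\<close> unfolding l by (auto simp: ennreal_less_iff simp del: of_nat_Suc)
  ultimately show ?thesis
    unfolding distr_fun_def E_def by blast
qed

text \<open>
  The rearrangement and the distribution function are generalised inverses of each other.
  The direction from right to left depends on right-continuity: the strict inequality must
  survive at a level slightly above \<open>l\<close>, otherwise the infimum could equal \<open>l\<close>.
\<close>

lemma less_rearrangement_iff:
  assumes f: "f \<in> borel_measurable half_line"
  shows "l < rearrangement f s \<longleftrightarrow> ennreal s < distr_fun f l"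
proof
  assume "l < rearrangement f s"
  then show "ennreal s < distr_fun f l"
    unfolding rearrangement_def by (metis (mono_tags) Inf_lower leD mem_Collect_eq not_le)
next
  assume "ennreal s < distr_fun f l"
  then obtain l' where "l < l'" and l': "ennreal s < distr_fun f l'"
    using distr_fun_right_continuous[OF f] by blast
  have "l' \<le> rearrangement f s"
    unfolding rearrangement_def
  proof (rule Inf_greatest)
    fix m assume "m \<in> {m. distr_fun f m \<le> ennreal s}"
    then show "l' \<le> m"
      using l' distr_fun_antimono[OF f, of m l'] by (metis leD le_less_linear less_imp_le mem_Collect_eq order_trans)
  qed
  with \<open>l < l'\<close> show "l < rearrangement f s" by (rule order_less_le_trans)
qed

lemma emeasure_truncated_ray:
  "emeasure (lebesgue_on {0<..<t}) {s \<in> {0<..<t}. ennreal s < m} = min (ennreal t) m"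
proof -
  have "emeasure (lebesgue_on {0<..<t}) {s \<in> {0<..<t}. ennreal s < m} =
    emeasure lborel {s \<in> {0<..<t}. ennreal s < m}"
    by (subst emeasure_restrict_space) auto
  also have "\<dots> = min (ennreal t) m"
  proof (cases m)
    case (real r)
    then have "{s \<in> {0<..<t}. ennreal s < m} = {0<..<min t r}"
      by (auto simp: ennreal_less_iff)
    with real show ?thesis
      by (cases "0 \<le> t") (auto simp: ennreal_neg min_def)
  next
    case top
    then have "{s \<in> {0<..<t}. ennreal s < m} = {0<..<t}" by auto
    with top show ?thesis by (cases "0 \<le> t") (auto simp: ennreal_neg )
  qed
  finally show ?thesis .
qed

lemma borel_measurable_rearrangement:
  assumes f: "f \<in> borel_measurable half_line"
  shows "rearrangement f \<in> borel_measurable (lebesgue_on {0<..<t})"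
proof (rule borel_measurableI_greater)
  fix y
  have "{s \<in> space lborel. ennreal s < distr_fun f y} \<in> sets lborel"
    by measurable
  then have "{0<..<t} \<inter> {s. ennreal s < distr_fun f y} \<in> sets (lebesgue_on {0<..<t})"
    by (subst sets_restrict_space_iff) auto
  then show "{s \<in> space (lebesgue_on {0<..<t}). y < rearrangement f s} \<in> sets (lebesgue_on {0<..<t})"
    by (simp add: less_rearrangement_iff[OF f] Int_def)
qed

lemma nn_integral_rearrangement_diff:
  assumes f: "f \<in> borel_measurable half_line" and "0 \<le> u"
  shows "(\<integral>\<^sup>+ s. rearrangement f s - ennreal u \<partial>lebesgue_on {0<..<t}) =
    (\<integral>\<^sup>+ l. indicator {u<..} l * min (ennreal t) (distr_fun f (ennreal l)) \<partial>lborel)"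
proof -
  have "(\<integral>\<^sup>+ s. rearrangement f s - ennreal u \<partial>lebesgue_on {0<..<t}) =
    (\<integral>\<^sup>+ l. indicator {u<..} l * emeasure (lebesgue_on {0<..<t})
       {s \<in> space (lebesgue_on {0<..<t}). ennreal l < rearrangement f s} \<partial>lborel)"
    by (rule nn_integral_diff_layer_cake)
      (use borel_measurable_rearrangement[OF f] \<open>0 \<le> u\<close> in \<open>auto intro!: sigma_finite_lebesgue_on\<close>)
  also have "\<dots> = (\<integral>\<^sup>+ l. indicator {u<..} l * min (ennreal t) (distr_fun f (ennreal l)) \<partial>lborel)"
    by (simp only: less_rearrangement_iff[OF f] emeasure_truncated_ray space_lebesgue_on)
  finally show ?thesis .
qed

lemma nn_integral_modulus_diff:
  assumes f: "f \<in> borel_measurable half_line" and "0 \<le> u"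
  shows "(\<integral>\<^sup>+ x. modulus f x - ennreal u \<partial>half_line) =
    (\<integral>\<^sup>+ l. indicator {u<..} l * distr_fun f (ennreal l) \<partial>lborel)"
  using nn_integral_diff_layer_cake[OF sigma_finite_lebesgue_on borel_measurable_modulus[OF f] \<open>0 \<le> u\<close>]
  by (simp add: distr_fun_def)

text \<open>
  Only the part of the rearrangement above the level \<open>u\<close> can exceed the rectangle of
  area \<open>t * u\<close>, and that part has no more mass than the part of the function itself above \<open>u\<close>,
  since truncating its layers to length \<open>t\<close> only shrinks them.
\<close>

lemma nn_integral_rearrangement_le:
  assumes f: "f \<in> borel_measurable half_line" and "0 \<le> u" and "0 < t"
  shows "(\<integral>\<^sup>+ s. rearrangement f s \<partial>lebesgue_on {0<..<t}) \<le>
    ennreal t * ennreal u + (\<integral>\<^sup>+ x. modulus f x - ennreal u \<partial>half_line)"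
proof -
  note [measurable] = borel_measurable_rearrangement[OF f]
  have "(\<integral>\<^sup>+ s. rearrangement f s \<partial>lebesgue_on {0<..<t}) \<le>
      (\<integral>\<^sup>+ s. ennreal u + (rearrangement f s - ennreal u) \<partial>lebesgue_on {0<..<t})"
    by (intro nn_integral_mono) (auto simp: add_diff_self_ennreal)
  also have "\<dots> = ennreal t * ennreal u + (\<integral>\<^sup>+ s. rearrangement f s - ennreal u \<partial>lebesgue_on {0<..<t})"
    using \<open>0 < t\<close> by (subst nn_integral_add) (auto simp: emeasure_restrict_space mult.commute)
  also have "(\<integral>\<^sup>+ s. rearrangement f s - ennreal u \<partial>lebesgue_on {0<..<t}) \<le>
      (\<integral>\<^sup>+ x. modulus f x - ennreal u \<partial>half_line)"
    unfolding nn_integral_rearrangement_diff[OF f \<open>0 \<le> u\<close>] nn_integral_modulus_diff[OF f \<open>0 \<le> u\<close>]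
    by (intro nn_integral_mono mult_left_mono) auto
  finally show ?thesis by (simp add: add_left_mono)
qed

text \<open>
  Under this bound the mean of the rearrangement over \<open>(0, t)\<close> is at most \<open>u\<close>, so the
  distribution function is at most \<open>t\<close> at every level above \<open>u\<close>. Hence cutting these layers to
  length \<open>t\<close>, as the rearrangement on \<open>(0, t)\<close> does, loses nothing.
\<close>

lemma nn_integral_modulus_diff_le:
  assumes f: "f \<in> borel_measurable half_line" and "0 \<le> u" and "0 < t"
    and le: "(\<integral>\<^sup>+ s. rearrangement f s \<partial>lebesgue_on {0<..<t}) \<le> ennreal t * ennreal u"
  shows "(\<integral>\<^sup>+ x. modulus f x - ennreal u \<partial>half_line) \<le> ennreal t * ennreal u"
proof -
  have eq: "(\<integral>\<^sup>+ s. rearrangement f s \<partial>lebesgue_on {0<..<t}) =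
    (\<integral>\<^sup>+ l. indicator {0<..} l * min (ennreal t) (distr_fun f (ennreal l)) \<partial>lborel)"
    using nn_integral_rearrangement_diff[OF f, of 0 t] by simp
  \<comment> \<open>If the distribution function exceeded \<open>t\<close> at \<open>u\<close>, it would do so up to some \<open>w > u\<close>,
    and the layers below \<open>w\<close> alone would have mass \<open>t * w > t * u\<close>.\<close>
  have distr_u: "distr_fun f (ennreal u) \<le> ennreal t"
  proof (rule ccontr)
    assume "\<not> ?thesis"
    then obtain l where "ennreal u < l" and l: "ennreal t < distr_fun f l"
      using distr_fun_right_continuous[OF f, of "ennreal t" "ennreal u"] by (auto simp: not_le)
    from l have "l \<noteq> top" by (auto simp: distr_fun_def)
    with \<open>ennreal u < l\<close> \<open>0 \<le> u\<close> obtain w where "u < w" and w: "l = ennreal w"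
      by (cases l) (auto simp: ennreal_less_iff)
    have "ennreal t * ennreal w = (\<integral>\<^sup>+ l. ennreal t * indicator {0<..<w} l \<partial>lborel)"
      using \<open>0 \<le> u\<close> \<open>u < w\<close> by (simp add: nn_integral_cmult_indicator)
    also have "\<dots> \<le> (\<integral>\<^sup>+ l. indicator {0<..} l * min (ennreal t) (distr_fun f (ennreal l)) \<partial>lborel)"
    proof (intro nn_integral_mono)
      fix x :: real
      have "ennreal t \<le> distr_fun f (ennreal x)" if "x < w"
        using l distr_fun_antimono[OF f, of "ennreal x" l] that w
        by (meson ennreal_leI less_imp_le order_trans)
      then show "ennreal t * indicator {0<..<w} x \<le> indicator {0<..} x * min (ennreal t) (distr_fun f (ennreal x))"
        by (auto split: split_indicator)
    qed
    also have "\<dots> \<le> ennreal t * ennreal u"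
      using le eq by simp
    finally show False
      using \<open>0 < t\<close> \<open>0 \<le> u\<close> \<open>u < w\<close> by (simp flip: ennreal_mult' )
  qed
  have "(\<integral>\<^sup>+ x. modulus f x - ennreal u \<partial>half_line) \<le>
      (\<integral>\<^sup>+ l. indicator {0<..} l * min (ennreal t) (distr_fun f (ennreal l)) \<partial>lborel)"
    unfolding nn_integral_modulus_diff[OF f \<open>0 \<le> u\<close>]
  proof (intro nn_integral_mono)
    fix l :: real
    have "distr_fun f (ennreal l) \<le> ennreal t" if "u < l"
      using distr_u distr_fun_antimono[OF f, of "ennreal u" "ennreal l"] that
      by (meson ennreal_leI less_imp_le order_trans)
    then show "indicator {u<..} l * distr_fun f (ennreal l)
        \<le> indicator {0<..} l * min (ennreal t) (distr_fun f (ennreal l))"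
      using \<open>0 \<le> u\<close> by (auto split: split_indicator)
  qed
  also have "\<dots> \<le> ennreal t * ennreal u"
    using le eq by simp
  finally show ?thesis .
qed

section \<open>The right-continuous inverse of a quasi-convex function\<close>

lemma at_left_infinity_neq_bot: "at_left (\<infinity>::ennreal) \<noteq> bot"
proof -
  have "eventually (\<lambda>_. False) (at_left (\<infinity>::ennreal)) \<longleftrightarrow> False"
    by (subst eventually_at_left[of 0]) (auto dest: dense)
  then show ?thesis by (simp add: trivial_limit_def)
qed

lemma ennreal_divide_mult_cancel:
  fixes a b :: ennreal
  assumes "0 < b" "b < \<infinity>"
  shows "a / b * b = a"
  using assms by (simp add: ennreal_divide_times)

lemma quasi_convex_cmult_le:
  assumes F: "quasi_convex F" and "0 < r" "r \<le> 1" "x < \<infinity>"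
  shows "F (r * x) \<le> r * F x"
proof (cases "x = 0")
  case True
  with F show ?thesis by (simp add: quasi_convex_def)
next
  case False
  have r: "r < \<infinity>" using \<open>r \<le> 1\<close> by (rule order_le_less_trans) simp
  have x: "0 < x" using False by (simp add: zero_less_iff_neq_zero)
  have rx: "0 < r * x" "r * x < \<infinity>"
    using x r assms(2,4) by (auto simp: ennreal_zero_less_mult_iff ennreal_mult_less_top)
  have "r * x \<le> x"
    using mult_right_mono[OF \<open>r \<le> 1\<close>, of x] by simp
  have "F (r * x) / (r * x) \<le> F x / x"
    using F rx \<open>r * x \<le> x\<close> x \<open>x < \<infinity>\<close> unfolding quasi_convex_def mono_on_def by simp
  then have "F (r * x) / (r * x) * (r * x) \<le> F x / x * (r * x)"
    by (rule mult_right_mono) simp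
  also have "F x / x * (r * x) = r * (F x / x * x)"
    by (simp only: ac_simps)
  finally show ?thesis
    by (simp only: ennreal_divide_mult_cancel[OF rx] ennreal_divide_mult_cancel[OF x \<open>x < \<infinity>\<close>])
qed

text \<open>
  Some positive value is attained at a finite point: otherwise left-continuity at infinity
  would make the function vanish there too. From that point on, monotonicity of \<open>F x / x\<close>
  gives linear growth.
\<close>

lemma quasi_convex_linear_growth:
  assumes F: "quasi_convex F"
  obtains c x0 where "0 < c" "c < \<infinity>" "0 < x0" "x0 < \<infinity>"
    "\<And>x. x0 \<le> x \<Longrightarrow> x < \<infinity> \<Longrightarrow> c * x \<le> F x"
proof -
  obtain x0 where "0 < x0" "x0 < \<infinity>" "F x0 \<noteq> 0"
  proof (rule ccontr, goal_cases)
    case no: 1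
    have zero: "F x = 0" if "x < \<infinity>" for x
    proof (cases "x = 0")
      case True
      with F show ?thesis by (simp add: quasi_convex_def)
    next
      case False
      with no that show ?thesis by (auto simp: zero_less_iff_neq_zero)
    qed
    have "eventually (\<lambda>x. F x = 0) (at_left \<infinity>)"
      unfolding eventually_at_filter by (auto simp: zero)
    moreover have "(F \<longlongrightarrow> F \<infinity>) (at_left \<infinity>)"
      using F by (auto simp: quasi_convex_def)
    ultimately have "F \<infinity> = 0"
      using at_left_infinity_neq_bot
      using tendsto_eventually tendsto_unique by blast
    with zero F show False
      unfolding quasi_convex_def by (metis less_top infinity_ennreal_def)
  qed
  \<comment> \<open>\<open>F x0\<close> may be infinite, so the slope is capped to keep it finite.\<close>
  define c where "c = min (F x0 / x0) 1"
  show thesis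
  proof
    show "0 < c" "c < \<infinity>"
      using \<open>F x0 \<noteq> 0\<close> \<open>x0 < \<infinity>\<close>
      by (auto simp: c_def min_less_iff_disj ennreal_zero_less_divide zero_less_iff_neq_zero)
    fix x assume x: "x0 \<le> x" "x < \<infinity>"
    have "0 < x" using \<open>0 < x0\<close> x(1) by (rule order_less_le_trans)
    have "F x0 / x0 \<le> F x / x"
      using F \<open>0 < x0\<close> \<open>0 < x\<close> \<open>x0 < \<infinity>\<close> x unfolding quasi_convex_def mono_on_def by simp
    then have "c * x \<le> F x / x * x"
      unfolding c_def by (intro mult_right_mono) (simp_all add: min.coboundedI1)
    also have "\<dots> = F x"
      using \<open>0 < x\<close> x(2) by (rule ennreal_divide_mult_cancel)
    finally show "c * x \<le> F x" .
  qed fact+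
qed

text \<open>
  Linear growth passes to infinity by left-continuity there. This is what excludes the point
  \<open>\<infinity>\<close> from the sets whose suprema define the inverse, where the monotonicity of \<open>F x / x\<close>
  says nothing.
\<close>

lemma quasi_convex_infinity:
  assumes F: "quasi_convex F"
  shows "F \<infinity> = \<infinity>"
proof (rule ccontr)
  assume "F \<infinity> \<noteq> \<infinity>"
  obtain c x0 where c: "0 < c" "c < \<infinity>" "0 < x0" "x0 < \<infinity>"
    "\<And>x. x0 \<le> x \<Longrightarrow> x < \<infinity> \<Longrightarrow> c * x \<le> F x"
    using quasi_convex_linear_growth[OF F] by metis
  have "((\<lambda>x. c * x) \<longlongrightarrow> c * \<infinity>) (at_left \<infinity>)"
    using c by (intro ennreal_tendsto_cmult tendsto_ident_at) auto
  moreover have "(F \<longlongrightarrow> F \<infinity>) (at_left \<infinity>)"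
    using F by (auto simp: quasi_convex_def)
  moreover have "eventually (\<lambda>x. c * x \<le> F x) (at_left \<infinity>)"
    using c by (subst eventually_at_left[of 0]) (auto intro!: exI[of _ x0])
  ultimately have "c * \<infinity> \<le> F \<infinity>"
    using at_left_infinity_neq_bot by (intro tendsto_le[of "at_left \<infinity>" F _ "\<lambda>x. c * x"]) auto
  with c \<open>F \<infinity> \<noteq> \<infinity>\<close> show False by (auto simp: ennreal_mult_top top_unique split: if_splits)
qed

lemma right_inverse_finite:
  assumes F: "quasi_convex F" and "s < \<infinity>"
  shows "right_inverse F s < \<infinity>"
proof -
  obtain c x0 where c: "0 < c" "c < \<infinity>" "0 < x0" "x0 < \<infinity>"
    "\<And>x. x0 \<le> x \<Longrightarrow> x < \<infinity> \<Longrightarrow> c * x \<le> F x"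
    using quasi_convex_linear_growth[OF F] by metis
  have "right_inverse F s \<le> max x0 (s / c)"
    unfolding right_inverse_def
  proof (rule Sup_least)
    fix x assume "x \<in> {x. F x \<le> s}"
    then have x: "F x \<le> s" by simp
    then have "x < \<infinity>"
      using quasi_convex_infinity[OF F] \<open>s < \<infinity>\<close> by (cases "x = \<infinity>") (auto simp: top_unique less_top)
    show "x \<le> max x0 (s / c)"
    proof (cases "x0 \<le> x")
      case True
      with c \<open>x < \<infinity>\<close> x have "c * x \<le> s" by (meson order_trans)
      then have "c * x / c \<le> s / c"
        by (rule divide_right_mono_ennreal)
      then have "x \<le> s / c"
        using c mult_divide_eq_ennreal[of c x] by (simp add: mult.commute)
      then show ?thesis by (simp add: max.coboundedI2)
    qed (simp add: le_max_iff_disj linorder_not_le less_imp_le)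
  qed
  also have "\<dots> < \<infinity>"
  proof -
    have "s / c < \<infinity>"
      using c \<open>s < \<infinity>\<close> by (auto simp: less_top[symmetric] ennreal_divide_eq_top_iff)
    with c show ?thesis by simp
  qed
  finally show ?thesis .
qed

text \<open>
  Since \<open>F (r * x) \<le> r * F x\<close>, scaling by \<open>r\<close> maps the set whose supremum is the inverse at \<open>s\<close>
  into the one for \<open>r * s\<close>. Thus the quotient of the inverse by its argument is non-increasing.
\<close>

lemma right_inverse_cmult_le:
  assumes F: "quasi_convex F" and "0 < r" "r \<le> 1" "s < \<infinity>"
  shows "r * right_inverse F s \<le> right_inverse F (r * s)"
proof -
  have "r * right_inverse F s = (SUP x\<in>{x. F x \<le> s}. r * x)"
    unfolding right_inverse_def
    using SUP_mult_left_ennreal[of r "\<lambda>x. x" "{x. F x \<le> s}"] by simp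
  also have "\<dots> \<le> right_inverse F (r * s)"
    unfolding right_inverse_def
  proof (rule SUP_least)
  fix x assume x: "x \<in> {x. F x \<le> s}"
  then have "x < \<infinity>"
    using quasi_convex_infinity[OF F] \<open>s < \<infinity>\<close> by (cases "x = \<infinity>") (auto simp: top_unique less_top)
  then have "F (r * x) \<le> r * F x"
    by (rule quasi_convex_cmult_le[OF assms(1-3)])
  also have "\<dots> \<le> r * s"
    using x by (intro mult_left_mono) auto
  finally show "r * x \<le> Sup {x. F x \<le> r * s}"
    by (intro Sup_upper) simp
  qed
  finally show ?thesis .
qed

lemma right_inverse_pos:
  assumes F: "quasi_convex F" and "0 < s"
  shows "0 < right_inverse F s"
proof -
  obtain x where "0 < x" "F x \<noteq> \<infinity>"
    using F unfolding quasi_convex_def by auto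
  with quasi_convex_infinity[OF F] have "x < \<infinity>" by (cases "x = \<infinity>") (auto simp: less_top)
  define r where "r = min 1 (s / F x)"
  have r: "0 < r" "r \<le> 1"
    using \<open>0 < s\<close> \<open>F x \<noteq> \<infinity>\<close> by (auto simp: r_def ennreal_zero_less_divide less_top)
  have "F (r * x) \<le> r * F x"
    by (rule quasi_convex_cmult_le[OF F r \<open>x < \<infinity>\<close>])
  also have "\<dots> \<le> s / F x * F x"
    unfolding r_def by (intro mult_right_mono) auto
  also have "\<dots> \<le> s"
    using \<open>F x \<noteq> \<infinity>\<close> ennreal_divide_mult_cancel[of "F x" s]
    by (cases "F x = 0") (auto simp: zero_less_iff_neq_zero less_top[symmetric])
  finally have "r * x \<le> right_inverse F s"
    unfolding right_inverse_def by (intro Sup_upper) simp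
  moreover have "0 < r * x"
    using r \<open>0 < x\<close> by (simp add: ennreal_zero_less_mult_iff)
  ultimately show ?thesis by (rule order_less_le_trans[rotated])
qed

section \<open>Young functions as sums of hinges\<close>

text \<open>
  Subtraction is not jointly continuous at infinite arguments, but subtracting a fixed finite
  number is left-continuous at \<open>\<infinity>\<close> too, because \<open>y < s - a\<close> means \<open>y + a < s\<close>.
\<close>

lemma tendsto_at_left_diff_ennreal:
  fixes a x :: ennreal
  assumes "a < \<infinity>"
  shows "((\<lambda>s. s - a) \<longlongrightarrow> x - a) (at_left x)"
proof (rule order_tendstoI)
  fix y assume "y < x - a"
  with assms have "y + a < x" by (simp add: less_diff_eq_ennreal)
  moreover have "((\<lambda>s. s) \<longlongrightarrow> x) (at_left x)" by (rule tendsto_ident_at)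
  ultimately have "eventually (\<lambda>s. y + a < s) (at_left x)" by (intro order_tendstoD)
  with assms show "eventually (\<lambda>s. y < s - a) (at_left x)" by (simp add: less_diff_eq_ennreal)
next
  fix y assume "x - a < y"
  moreover have "s - a \<le> x - a" if "s < x" for s
    using that by (intro ennreal_minus_mono) auto
  ultimately show "eventually (\<lambda>s. s - a < y) (at_left x)"
    unfolding eventually_at_filter by (intro always_eventually) (auto intro: order_le_less_trans)
qed

text \<open>
  A series of non-decreasing functions is a supremum of finite partial sums, so left-continuity
  survives the infinite sum: partial sums bound it from below near \<open>x\<close>, monotonicity from above.
\<close>

lemma tendsto_at_left_suminf_ennreal:
  fixes b :: "nat \<Rightarrow> ennreal \<Rightarrow> ennreal"
  assumes "\<And>k. (b k \<longlongrightarrow> b k x) (at_left x)" and "\<And>k. mono (b k)"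
  shows "((\<lambda>s. \<Sum>k. b k s) \<longlongrightarrow> (\<Sum>k. b k x)) (at_left x)"
proof (rule order_tendstoI)
  fix y assume "y < (\<Sum>k. b k x)"
  then obtain n where n: "y < (\<Sum>k<n. b k x)"
    by (auto simp: suminf_eq_SUP less_SUP_iff)
  have "((\<lambda>s. \<Sum>k<n. b k s) \<longlongrightarrow> (\<Sum>k<n. b k x)) (at_left x)"
    using assms(1) by (intro tendsto_sum)
  then have "eventually (\<lambda>s. y < (\<Sum>k<n. b k s)) (at_left x)"
    using n by (rule order_tendstoD)
  then show "eventually (\<lambda>s. y < (\<Sum>k. b k s)) (at_left x)"
    by eventually_elim (rule order_less_le_trans, assumption, rule sum_le_suminf, auto)
next
  fix y assume "(\<Sum>k. b k x) < y"
  moreover have "(\<Sum>k. b k s) \<le> (\<Sum>k. b k x)" if "s < x" for s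
    using that assms(2) by (intro suminf_le) (auto simp: mono_def)
  ultimately show "eventually (\<lambda>s. (\<Sum>k. b k s) < y) (at_left x)"
    unfolding eventually_at_filter by (intro always_eventually) (auto intro: order_le_less_trans)
qed

lemma hinge_convex:
  fixes a s t u v :: ennreal
  assumes "u + v = 1" and "a < \<infinity>"
  shows "u * s + v * t - a \<le> u * (s - a) + v * (t - a)"
proof -
  have "u * s + v * t \<le> u * (a + (s - a)) + v * (a + (t - a))"
    by (intro add_mono mult_left_mono) (auto simp: add_diff_self_ennreal)
  also have "\<dots> = (u + v) * a + (u * (s - a) + v * (t - a))"
    by (simp add: algebra_simps)
  finally have le: "u * s + v * t \<le> a + (u * (s - a) + v * (t - a))"
    using \<open>u + v = 1\<close> by simp
  with \<open>a < \<infinity>\<close> show ?thesis by (auto simp: less_top[symmetric] ennreal_minus_le_iff)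
qed

text \<open>
  A point \<open>s \<le> t\<close> is the convex combination of \<open>t\<close> and \<open>0\<close> with weight \<open>s / t\<close> on \<open>t\<close>.
\<close>

lemma convex_imp_quotient_mono:
  fixes A :: "ennreal \<Rightarrow> ennreal"
  assumes "A 0 = 0"
    and convex: "\<And>s t u v. u + v = 1 \<Longrightarrow> A (u * s + v * t) \<le> u * A s + v * A t"
  shows "mono_on {0<..<\<infinity>} (\<lambda>t. A t / t)"
proof (rule mono_onI)
  fix s t :: ennreal assume s: "s \<in> {0<..<\<infinity>}" and t: "t \<in> {0<..<\<infinity>}" and "s \<le> t"
  have "s / t \<le> t / t"
    using \<open>s \<le> t\<close> by (rule divide_right_mono_ennreal)
  also have "t / t = 1" using t by (intro ennreal_divide_self) auto
  finally have "s / t + (1 - s / t) = 1"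
    by (simp add: add_diff_self_ennreal)
  from convex[OF this, of t 0] have "A (s / t * t) \<le> s / t * A t"
    using \<open>A 0 = 0\<close> by simp
  then have "A s \<le> s / t * A t"
    using t by (simp add: ennreal_divide_mult_cancel)
  then have "A s / s \<le> s / t * A t / s"
    by (rule divide_right_mono_ennreal)
  also have "\<dots> = A t / t"
    using s mult_divide_eq_ennreal[of s "A t / t"]
    by (auto simp: zero_less_iff_neq_zero less_top[symmetric] ennreal_times_divide ennreal_divide_times ac_simps)
  finally show "A s / s \<le> A t / t" .
qed

text \<open>
  Every requirement on a Young function passes from the hinges \<open>x - a\<close> (truncated at \<open>0\<close>)
  to their positive combinations, except that the sum might be infinite on all of \<open>(0, \<infinity>]\<close>.
  Finiteness at a single positive point is therefore the only global hypothesis.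
\<close>

lemma young_function_suminf_hinges:
  fixes a c :: "nat \<Rightarrow> ennreal"
  assumes a: "\<And>k. a k < \<infinity>" and c: "\<And>k. c k < \<infinity>" "\<And>k. 0 < c k"
    and x0: "0 < x0" "(\<Sum>k. c k * (x0 - a k)) < \<infinity>"
  shows "young_function (\<lambda>x. \<Sum>k. c k * (x - a k))"
proof -
  let ?B = "\<lambda>x. \<Sum>k. c k * (x - a k)"
  have convex: "?B (u * s + v * t) \<le> u * ?B s + v * ?B t" if "u + v = 1" for s t u v
  proof -
    have "?B (u * s + v * t) \<le> (\<Sum>k. u * (c k * (s - a k)) + v * (c k * (t - a k)))"
    proof (intro suminf_le)
      fix k
      have "c k * (u * s + v * t - a k) \<le> c k * (u * (s - a k) + v * (t - a k))"
        by (intro mult_left_mono hinge_convex that a) simp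
      then show "c k * (u * s + v * t - a k) \<le> u * (c k * (s - a k)) + v * (c k * (t - a k))"
        by (simp add: algebra_simps)
    qed auto
    also have "\<dots> = u * ?B s + v * ?B t"
      by (simp flip: suminf_add)
    finally show ?thesis .
  qed
  have "(?B \<longlongrightarrow> ?B x) (at_left x)" for x
    using a c by (intro tendsto_at_left_suminf_ennreal ennreal_tendsto_cmult tendsto_at_left_diff_ennreal)
      (auto simp: mono_def intro!: mult_left_mono ennreal_minus_mono)
  moreover have "?B \<infinity> \<noteq> 0"
  proof -
    have "c 0 * (\<infinity> - a 0) \<le> ?B \<infinity>"
      using sum_le_suminf[of "\<lambda>k. c k * (\<infinity> - a k)" "{0}"] by simp
    moreover have "c 0 * (\<infinity> - a 0) \<noteq> 0"
      using c(2)[of 0] by simp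
    ultimately show ?thesis by (metis le_zero_eq)
  qed
  then have "\<not> (\<forall>t>0. ?B t = 0)"
    by (metis infinity_ennreal_def ennreal_zero_less_top)
  moreover have "\<not> (\<forall>t>0. ?B t = \<infinity>)"
    using x0 by (metis less_irrefl)
  moreover have "?B 0 = 0" by simp
  moreover from this convex have "mono_on {0<..<\<infinity>} (\<lambda>t. ?B t / t)"
    by (rule convex_imp_quotient_mono)
  ultimately show ?thesis
    using convex unfolding young_function_def quasi_convex_def by blast
qed

section \<open>Hinges adapted to a weak Orlicz space\<close>

text \<open>
  This is the reciprocal of \<open>sharp_inverse F t\<close>, hence the bound that membership in the unit
  ball of the weak Orlicz space imposes on the maximal rearrangement at \<open>t\<close>.
\<close>

definition hinge_point :: "(ennreal \<Rightarrow> ennreal) \<Rightarrow> real \<Rightarrow> ennreal" where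
  "hinge_point F t = right_inverse F (1 / ennreal t)"

text \<open>
  The hinge at \<open>a = hinge_point F t\<close> is divided by \<open>t * a\<close>, which bounds the integral of the
  truncation at \<open>a\<close> of every function in the unit ball. The geometric weights sum to \<open>1\<close>, so the
  whole sum has integral at most \<open>1\<close> on the unit ball, while any sequence \<open>\<tau>\<close> of positive
  reals is admissible.
\<close>

definition hinge_sum :: "(ennreal \<Rightarrow> ennreal) \<Rightarrow> (nat \<Rightarrow> real) \<Rightarrow> ennreal \<Rightarrow> ennreal" where
  "hinge_sum F \<tau> x = (\<Sum>k. ennreal ((1/2) ^ Suc k) / (ennreal (\<tau> k) * hinge_point F (\<tau> k))
     * (x - hinge_point F (\<tau> k)))"

lemma hinge_point_bounds:
  assumes "quasi_convex F" "0 < t"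
  shows "0 < hinge_point F t" "hinge_point F t < \<infinity>"
proof -
  have "0 < 1 / ennreal t" "1 / ennreal t < \<infinity>"
    using \<open>0 < t\<close> by (auto simp: ennreal_zero_less_divide less_top[symmetric] ennreal_divide_eq_top_iff)
  with assms show "0 < hinge_point F t" "hinge_point F t < \<infinity>"
    unfolding hinge_point_def by (blast intro: right_inverse_pos right_inverse_finite)+
qed

lemma suminf_half_powers: "(\<Sum>k. ennreal ((1/2) ^ Suc k)) = 1"
  by (subst suminf_ennreal_eq[OF _ power_half_series]) auto

text \<open>
  The sum is finite at \<open>right_inverse F 1\<close>, whatever the sequence: a hinge with \<open>\<tau> k \<le> 1\<close>
  starts at or after this point, and for \<open>\<tau> k > 1\<close> the inequality for rays keeps the normalising
  factor \<open>\<tau> k * hinge_point F (\<tau> k)\<close> at least as large as this point.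
\<close>

lemma hinge_sum_le_one:
  assumes F: "quasi_convex F" and \<tau>: "\<And>k. 0 < \<tau> k"
  shows "hinge_sum F \<tau> (right_inverse F 1) \<le> 1"
proof -
  have "hinge_sum F \<tau> (right_inverse F 1) \<le> (\<Sum>k. ennreal ((1/2) ^ Suc k))"
    unfolding hinge_sum_def
  proof (intro suminf_le)
    fix k
    let ?a = "hinge_point F (\<tau> k)" and ?t = "ennreal (\<tau> k)"
    note a = hinge_point_bounds[OF F \<tau>[of k]]
    have t: "0 < ?t" "?t < \<infinity>" using \<tau>[of k] by auto
    have ta: "0 < ?t * ?a" "?t * ?a < \<infinity>"
      using a t by (auto simp: ennreal_zero_less_mult_iff ennreal_mult_less_top)
    have "right_inverse F 1 - ?a \<le> ?t * ?a"
    proof (cases "\<tau> k \<le> 1")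
      case True
      then have "?t / ?t \<le> 1 / ?t"
        by (intro divide_right_mono_ennreal) simp
      then have "1 \<le> 1 / ?t" using t by simp
      then have "right_inverse F 1 \<le> ?a"
        unfolding hinge_point_def right_inverse_def
        by (intro Sup_subset_mono) auto
      then have "right_inverse F 1 - ?a = 0"
        using a by (intro diff_eq_0_ennreal) (auto intro: order_le_less_trans)
      then show ?thesis by simp
    next
      case False
      then have "1 / ?t \<le> ?t / ?t"
        by (intro divide_right_mono_ennreal) simp
      then have "1 / ?t \<le> 1" using t by simp
      moreover have "0 < 1 / ?t" using t by (simp add: ennreal_zero_less_divide)
      ultimately have "1 / ?t * right_inverse F 1 \<le> ?a"
        using right_inverse_cmult_le[OF F, of "1 / ?t" 1] by (simp add: hinge_point_def)
      then have "?t * (1 / ?t * right_inverse F 1) \<le> ?t * ?a"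
        by (rule mult_left_mono) simp
      moreover have "?t * (1 / ?t * right_inverse F 1) = right_inverse F 1"
        using ennreal_divide_mult_cancel[OF t, of 1] by (metis mult.assoc mult.commute mult_1)
      ultimately show ?thesis by (metis diff_le_self_ennreal order_trans)
    qed
    then have "ennreal ((1/2) ^ Suc k) / (?t * ?a) * (right_inverse F 1 - ?a)
      \<le> ennreal ((1/2) ^ Suc k) / (?t * ?a) * (?t * ?a)"
      by (rule mult_left_mono) simp
    then show "ennreal ((1/2) ^ Suc k) / (?t * ?a) * (right_inverse F 1 - ?a) \<le> ennreal ((1/2) ^ Suc k)"
      by (simp only: ennreal_divide_mult_cancel[OF ta])
  qed auto
  then show ?thesis by (simp only: suminf_half_powers)
qed

lemma young_function_hinge_sum:
  assumes F: "quasi_convex F" and \<tau>: "\<And>k. 0 < \<tau> k"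
  shows "young_function (hinge_sum F \<tau>)"
  unfolding hinge_sum_def[abs_def]
proof (rule young_function_suminf_hinges)
  fix k
  note a = hinge_point_bounds[OF F \<tau>[of k]]
  show "hinge_point F (\<tau> k) < \<infinity>" by (rule a)
  have "0 < ennreal (\<tau> k) * hinge_point F (\<tau> k)" "ennreal (\<tau> k) * hinge_point F (\<tau> k) < \<infinity>"
    using a \<tau>[of k] by (auto simp: ennreal_zero_less_mult_iff ennreal_mult_less_top)
  then show "ennreal ((1/2) ^ Suc k) / (ennreal (\<tau> k) * hinge_point F (\<tau> k)) < \<infinity>"
    "0 < ennreal ((1/2) ^ Suc k) / (ennreal (\<tau> k) * hinge_point F (\<tau> k))"
    by (auto simp: less_top[symmetric] ennreal_divide_eq_top_iff ennreal_zero_less_divide)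
next
  show "0 < right_inverse F 1"
    using F by (intro right_inverse_pos) auto
  show "(\<Sum>k. ennreal ((1/2) ^ Suc k) / (ennreal (\<tau> k) * hinge_point F (\<tau> k))
     * (right_inverse F 1 - hinge_point F (\<tau> k))) < \<infinity>"
    using hinge_sum_le_one[OF F \<tau>] unfolding hinge_sum_def by (rule order_le_less_trans) simp
qed

text \<open>
  Clearing the denominators is legitimate in both directions because the hinge point is
  positive and finite.
\<close>

lemma maximal_rearrangement_le_iff:
  assumes F: "quasi_convex F" and "0 < t" "l < \<infinity>"
  shows "sharp_inverse F (ennreal t) * maximal_rearrangement f t \<le> l \<longleftrightarrow>
    (\<integral>\<^sup>+ s. rearrangement f s \<partial>lebesgue_on {0<..<t}) \<le> ennreal t * (l * hinge_point F t)"
    (is "_ \<longleftrightarrow> ?T \<le> _")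
proof -
  let ?a = "hinge_point F t" and ?t = "ennreal t"
  note a = hinge_point_bounds[OF F \<open>0 < t\<close>]
  have t: "0 < ?t" "?t < \<infinity>" using \<open>0 < t\<close> by auto
  have ta: "0 < ?t * ?a" "?t * ?a < \<infinity>"
    using a t by (auto simp: ennreal_zero_less_mult_iff ennreal_mult_less_top)
  have "sharp_inverse F (ennreal t) * maximal_rearrangement f t = 1 / ?a * (1 / ?t * ?T)"
    by (simp add: sharp_inverse_def maximal_rearrangement_def hinge_point_def)
  also have "\<dots> \<le> l \<longleftrightarrow> ?T \<le> ?t * (l * ?a)" (is "?X \<le> l \<longleftrightarrow> _")
  proof
    have X: "?X * (?t * ?a) = ?T"
    proof -
      have "?X * (?t * ?a) = (1 / ?a * ?a) * ((1 / ?t * ?t) * ?T)" by (simp only: ac_simps)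
      then show ?thesis by (simp only: ennreal_divide_mult_cancel[OF a] ennreal_divide_mult_cancel[OF t] mult_1)
    qed
    show "?T \<le> ?t * (l * ?a)" if "?X \<le> l"
    proof -
      have "?T \<le> l * (?t * ?a)"
        using mult_right_mono[OF that, of "?t * ?a"] unfolding X by simp
      then show ?thesis by (simp only: ac_simps)
    qed
    show "?X \<le> l" if "?T \<le> ?t * (l * ?a)"
    proof -
      have "?X * (?t * ?a) \<le> l * (?t * ?a)"
        unfolding X using that by (simp only: ac_simps)
      then have "?X * (?t * ?a) / (?t * ?a) \<le> l * (?t * ?a) / (?t * ?a)"
        by (rule divide_right_mono_ennreal)
      then show ?thesis
        using ta by (subst (asm) (1 2) mult_divide_eq_ennreal) auto
    qed
  qed
  finally show ?thesis .
qed

text \<open>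
  Dividing the function by \<open>l\<close> is traded for multiplying each hinge point by \<open>l\<close>, so that only
  truncations of the function itself have to be integrated.
\<close>

lemma nn_integral_hinge_sum:
  assumes F: "quasi_convex F" and \<tau>: "\<And>k. 0 < \<tau> k" and f: "f \<in> borel_measurable half_line"
    and l: "0 < l" "l < \<infinity>"
  shows "(\<integral>\<^sup>+ x. hinge_sum F \<tau> (modulus f x / l) \<partial>half_line) =
    (\<Sum>k. ennreal ((1/2) ^ Suc k) / (ennreal (\<tau> k) * (l * hinge_point F (\<tau> k)))
      * (\<integral>\<^sup>+ x. modulus f x - l * hinge_point F (\<tau> k) \<partial>half_line))"
proof -
  note [measurable] = borel_measurable_modulus[OF f]
  have scale: "ennreal ((1/2) ^ Suc k) / (ennreal (\<tau> k) * hinge_point F (\<tau> k)) * (m / l - hinge_point F (\<tau> k)) =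
     ennreal ((1/2) ^ Suc k) / (ennreal (\<tau> k) * (l * hinge_point F (\<tau> k))) * (m - l * hinge_point F (\<tau> k))"
    for m k
  proof -
    note a = hinge_point_bounds[OF F \<tau>[of k]]
    obtain a where a: "hinge_point F (\<tau> k) = ennreal a" "0 < a"
      using a by (cases "hinge_point F (\<tau> k)") auto
    obtain r where r: "l = ennreal r" "0 < r"
      using l by (cases l) auto
    define p :: real where "p = (1/2) ^ Suc k"
    have "0 < p" by (simp add: p_def)
    have c: "ennreal p / (ennreal (\<tau> k) * ennreal a) = ennreal (p / (\<tau> k * a))"
      "ennreal p / (ennreal (\<tau> k) * (ennreal r * ennreal a)) = ennreal (p / (\<tau> k * (r * a)))"
      using a r \<tau>[of k] \<open>0 < p\<close> by (simp_all flip: ennreal_mult' add: divide_ennreal)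
    have pos: "0 < p / (\<tau> k * a)" "0 < p / (\<tau> k * (r * a))"
      using a r \<tau>[of k] \<open>0 < p\<close> by auto
    show ?thesis
      unfolding a r p_def[symmetric] c
    proof (cases m)
      case (real q)
      have "p / (\<tau> k * a) * (q / r - a) = p / (\<tau> k * (r * a)) * (q - r * a)"
        using a(2) r(2) \<tau>[of k] by (simp add: field_simps)
      then show "ennreal (p / (\<tau> k * a)) * (m / ennreal r - ennreal a) =
          ennreal (p / (\<tau> k * (r * a))) * (m - ennreal r * ennreal a)"
        using real a(2) r(2) pos
        by (simp add: divide_ennreal ennreal_minus flip: ennreal_mult' del: times_divide_eq_left times_divide_eq_right)
    next
      case top
      then show "ennreal (p / (\<tau> k * a)) * (m / ennreal r - ennreal a) =
          ennreal (p / (\<tau> k * (r * a))) * (m - ennreal r * ennreal a)"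
        using pos r(2) by (simp add: ennreal_top_divide ennreal_mult_top)
    qed
  qed
  have "(\<integral>\<^sup>+ x. hinge_sum F \<tau> (modulus f x / l) \<partial>half_line) =
    (\<Sum>k. \<integral>\<^sup>+ x. ennreal ((1/2) ^ Suc k) / (ennreal (\<tau> k) * (l * hinge_point F (\<tau> k)))
      * (modulus f x - l * hinge_point F (\<tau> k)) \<partial>half_line)"
    unfolding hinge_sum_def scale by (rule nn_integral_suminf) measurable
  also have "\<dots> = (\<Sum>k. ennreal ((1/2) ^ Suc k) / (ennreal (\<tau> k) * (l * hinge_point F (\<tau> k)))
      * (\<integral>\<^sup>+ x. modulus f x - l * hinge_point F (\<tau> k) \<partial>half_line))"
    by (intro suminf_cong nn_integral_cmult) measurable
  finally show ?thesis .
qed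


section \<open>Weak Orlicz spaces as intersections of Orlicz spaces\<close>

text \<open>
  The embedding has constant \<open>1\<close> for every sequence \<open>\<tau>\<close>: if \<open>l\<close> exceeds the weak norm, the
  mean of the rearrangement over \<open>(0, \<tau> k)\<close> is at most \<open>l * hinge_point F (\<tau> k)\<close>, and
  \<open>nn_integral_modulus_diff_le\<close> bounds the \<open>k\<close>-th integral by its normalising factor.
\<close>

lemma norm_embeds_hinge_sum:
  assumes F: "quasi_convex F" and \<tau>: "\<And>k. 0 < \<tau> k"
  shows "norm_embeds (weak_orlicz_norm F) (orlicz_norm (hinge_sum F \<tau>))"
  unfolding norm_embeds_def
proof (intro exI conjI ballI)
  show "(0::real) < 1" by simp
  fix f assume "f \<in> finite_norm_space (weak_orlicz_norm F)"
  then have f: "f \<in> borel_measurable half_line" by (simp add: finite_norm_space_def)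
  have "orlicz_norm (hinge_sum F \<tau>) f \<le> weak_orlicz_norm F f"
  \<comment> \<open>Strictly larger \<open>l\<close> are used because the weak norm itself may be \<open>0\<close>,
    while the Orlicz norm only admits positive scalings.\<close>
  proof (rule dense_ge)
    fix l assume less: "weak_orlicz_norm F f < l"
    then have "0 < l" by (rule order_le_less_trans[rotated]) simp
    show "orlicz_norm (hinge_sum F \<tau>) f \<le> l"
    proof (cases "l = \<infinity>")
      case False
      then have "l < \<infinity>" by (simp add: less_top)
      have "(\<integral>\<^sup>+ x. hinge_sum F \<tau> (modulus f x / l) \<partial>half_line) \<le> (\<Sum>k. ennreal ((1/2) ^ Suc k))"
        unfolding nn_integral_hinge_sum[OF F \<tau> f \<open>0 < l\<close> \<open>l < \<infinity>\<close>]
      proof (intro suminf_le)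
        fix k
        note a = hinge_point_bounds[OF F \<tau>[of k]]
        let ?D = "ennreal (\<tau> k) * (l * hinge_point F (\<tau> k))"
        have D: "0 < ?D" "?D < \<infinity>"
          using a \<tau>[of k] \<open>0 < l\<close> \<open>l < \<infinity>\<close> by (auto simp: ennreal_zero_less_mult_iff ennreal_mult_less_top)
        have "l * hinge_point F (\<tau> k) < \<infinity>"
          using a \<open>l < \<infinity>\<close> by (simp add: ennreal_mult_less_top)
        then obtain u where u: "l * hinge_point F (\<tau> k) = ennreal u" "0 \<le> u"
          by (cases "l * hinge_point F (\<tau> k)") auto
        have "sharp_inverse F (ennreal (\<tau> k)) * maximal_rearrangement f (\<tau> k) \<le> weak_orlicz_norm F f"
          unfolding weak_orlicz_norm_def using \<tau>[of k] by (intro SUP_upper) simp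
        also have "\<dots> \<le> l" using less by simp
        finally have "(\<integral>\<^sup>+ x. modulus f x - l * hinge_point F (\<tau> k) \<partial>half_line) \<le> ?D"
          unfolding maximal_rearrangement_le_iff[OF F \<tau> \<open>l < \<infinity>\<close>] u
          by (rule nn_integral_modulus_diff_le[OF f u(2) \<tau>])
        then have "ennreal ((1/2) ^ Suc k) / ?D * (\<integral>\<^sup>+ x. modulus f x - l * hinge_point F (\<tau> k) \<partial>half_line)
            \<le> ennreal ((1/2) ^ Suc k) / ?D * ?D"
          by (rule mult_left_mono) simp
        then show "ennreal ((1/2) ^ Suc k) / ?D * (\<integral>\<^sup>+ x. modulus f x - l * hinge_point F (\<tau> k) \<partial>half_line)
            \<le> ennreal ((1/2) ^ Suc k)"
          by (simp only: ennreal_divide_mult_cancel[OF D])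
      qed auto
      then have "(\<integral>\<^sup>+ x. hinge_sum F \<tau> (modulus f x / l) \<partial>half_line) \<le> 1"
        by (simp only: suminf_half_powers)
      with \<open>0 < l\<close> \<open>l < \<infinity>\<close> show ?thesis
        unfolding orlicz_norm_def by (intro Inf_lower) simp
    qed simp
  qed
  then show "orlicz_norm (hinge_sum F \<tau>) f \<le> ennreal 1 * weak_orlicz_norm F f" by simp
qed

text \<open>
  A partial converse of the embedding, at the points of the sequence only. Each single hinge
  carries the weight \<open>2 ^ - (k + 1)\<close>, which costs the factor \<open>2 ^ (k + 1)\<close>; the added \<open>1\<close> comes from
  the mass below the hinge point. The scale \<open>l\<close> depends on the sequence but not on \<open>k\<close>, and the
  other factor depends on \<open>k\<close> alone, so a sequence can be chosen in advance to outgrow the bound.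
\<close>

lemma maximal_rearrangement_bound_of_orlicz:
  assumes F: "quasi_convex F" and \<tau>: "\<And>k. 0 < \<tau> k" and f: "f \<in> orlicz_space (hinge_sum F \<tau>)"
  obtains l where "0 < l" "l < \<infinity>"
    "\<And>k. sharp_inverse F (ennreal (\<tau> k)) * maximal_rearrangement f (\<tau> k) \<le> ennreal (1 + 2 ^ Suc k) * l"
proof -
  from f have fm: "f \<in> borel_measurable half_line" and "orlicz_norm (hinge_sum F \<tau>) f < \<infinity>"
    by (auto simp: orlicz_space_def finite_norm_space_def)
  then obtain l where l: "0 < l" "l < \<infinity>" and le1: "(\<integral>\<^sup>+ x. hinge_sum F \<tau> (modulus f x / l) \<partial>half_line) \<le> 1"
    unfolding orlicz_norm_def Inf_less_iff by blast
  show thesis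
  proof (rule that[OF l])
    fix k
    note a = hinge_point_bounds[OF F \<tau>[of k]]
    let ?D = "ennreal (\<tau> k) * (l * hinge_point F (\<tau> k))"
    let ?I = "\<integral>\<^sup>+ x. modulus f x - l * hinge_point F (\<tau> k) \<partial>half_line"
    have D: "0 < ?D" "?D < \<infinity>"
      using a \<tau>[of k] l by (auto simp: ennreal_zero_less_mult_iff ennreal_mult_less_top)
    have "l * hinge_point F (\<tau> k) < \<infinity>"
      using a l by (simp add: ennreal_mult_less_top)
    then obtain u where u: "l * hinge_point F (\<tau> k) = ennreal u" "0 \<le> u"
      by (cases "l * hinge_point F (\<tau> k)") auto
    have "ennreal ((1/2) ^ Suc k) / ?D * ?I \<le> (\<integral>\<^sup>+ x. hinge_sum F \<tau> (modulus f x / l) \<partial>half_line)"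
      unfolding nn_integral_hinge_sum[OF F \<tau> fm l]
      using sum_le_suminf[of "\<lambda>k. ennreal ((1/2) ^ Suc k) / (ennreal (\<tau> k) * (l * hinge_point F (\<tau> k)))
        * (\<integral>\<^sup>+ x. modulus f x - l * hinge_point F (\<tau> k) \<partial>half_line)" "{k}"] by simp
    also note le1
    finally have "ennreal (2 ^ Suc k) * ?D * (ennreal ((1/2) ^ Suc k) / ?D * ?I) \<le> ennreal (2 ^ Suc k) * ?D * 1"
      by (rule mult_left_mono) simp
    moreover have "ennreal (2 ^ Suc k) * ?D * (ennreal ((1/2) ^ Suc k) / ?D * ?I) = ?I"
    proof -
      have "ennreal (2 ^ Suc k) * ennreal ((1/2) ^ Suc k) = 1"
        by (simp flip: ennreal_mult' power_mult_distrib del: power_Suc)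
      moreover have "ennreal (2 ^ Suc k) * ?D * (ennreal ((1/2) ^ Suc k) / ?D * ?I)
        = ennreal (2 ^ Suc k) * (ennreal ((1/2) ^ Suc k) / ?D * ?D) * ?I"
        by (simp only: ac_simps)
      ultimately show ?thesis by (simp only: ennreal_divide_mult_cancel[OF D] mult_1)
    qed
    ultimately have I: "?I \<le> ennreal (2 ^ Suc k) * ?D" by simp
    have "(\<integral>\<^sup>+ s. rearrangement f s \<partial>lebesgue_on {0<..<\<tau> k}) \<le> ?D + ?I"
      unfolding u by (rule nn_integral_rearrangement_le[OF fm u(2) \<tau>])
    also have "\<dots> \<le> ?D + ennreal (2 ^ Suc k) * ?D"
      using I by (rule add_left_mono)
    also have "\<dots> = ennreal (1 + 2 ^ Suc k) * ?D"
      by (simp add: distrib_right del: power_Suc)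
    also have "\<dots> = ennreal (\<tau> k) * (ennreal (1 + 2 ^ Suc k) * l * hinge_point F (\<tau> k))"
      by (simp only: ac_simps)
    finally show "sharp_inverse F (ennreal (\<tau> k)) * maximal_rearrangement f (\<tau> k) \<le> ennreal (1 + 2 ^ Suc k) * l"
      using l by (subst maximal_rearrangement_le_iff[OF F \<tau>]) (auto simp: ennreal_mult_less_top simp del: ennreal_plus)
  qed
qed

theorem theorem2p8:
  fixes F :: "ennreal \<Rightarrow> ennreal"
  assumes "quasi_convex F"
  shows "weak_orlicz_space F =
    (\<Inter>B \<in> {B. young_function B \<and> norm_embeds (weak_orlicz_norm F) (orlicz_norm B)}.
       orlicz_space B)"
proof (intro equalityI subsetI)
  fix f assume f: "f \<in> weak_orlicz_space F"
  have "f \<in> orlicz_space B" if "norm_embeds (weak_orlicz_norm F) (orlicz_norm B)" for B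
  proof -
    from that f obtain C where "orlicz_norm B f \<le> ennreal C * weak_orlicz_norm F f"
      unfolding norm_embeds_def weak_orlicz_space_def by blast
    also have "\<dots> < \<infinity>"
      using f by (simp add: weak_orlicz_space_def finite_norm_space_def ennreal_mult_less_top)
    finally show ?thesis
      using f by (simp add: orlicz_space_def weak_orlicz_space_def finite_norm_space_def)
  qed
  then show "f \<in> (\<Inter>B \<in> {B. young_function B \<and> norm_embeds (weak_orlicz_norm F) (orlicz_norm B)}.
       orlicz_space B)" by blast
next
  fix f assume f: "f \<in> (\<Inter>B \<in> {B. young_function B \<and> norm_embeds (weak_orlicz_norm F) (orlicz_norm B)}.
       orlicz_space B)"
  have mem: "f \<in> orlicz_space (hinge_sum F \<tau>)" if "\<And>k. 0 < \<tau> k" for \<tau>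
    using INT_D[OF f, of "hinge_sum F \<tau>"] young_function_hinge_sum[of F \<tau>, OF assms that]
      norm_embeds_hinge_sum[of F \<tau>, OF assms that]
    by simp
  \<comment> \<open>Any one sequence shows measurability, since membership in a single Orlicz space includes it.\<close>
  have meas: "f \<in> borel_measurable half_line"
    using mem[of "\<lambda>_. 1"] by (simp add: orlicz_space_def finite_norm_space_def)
  have "weak_orlicz_norm F f < \<infinity>"
  proof (rule ccontr)
    assume "\<not> ?thesis"
    then have "weak_orlicz_norm F f = \<infinity>"
      by (simp add: less_top[symmetric])
    then have "ennreal (real k * (1 + 2 ^ Suc k)) < weak_orlicz_norm F f" for k :: nat
      by (simp only: infinity_ennreal_def ennreal_less_top)
    then have "\<exists>t>0. ennreal (real k * (1 + 2 ^ Suc k)) <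
        sharp_inverse F (ennreal t) * maximal_rearrangement f t" for k :: nat
      unfolding weak_orlicz_norm_def less_SUP_iff by auto
    then obtain \<tau> where \<tau>: "\<And>k. 0 < \<tau> k"
      and large: "\<And>k. ennreal (real k * (1 + 2 ^ Suc k)) <
        sharp_inverse F (ennreal (\<tau> k)) * maximal_rearrangement f (\<tau> k)"
      by metis
    obtain l where l: "0 < l" "l < \<infinity>" and
      small: "\<And>k. sharp_inverse F (ennreal (\<tau> k)) * maximal_rearrangement f (\<tau> k) \<le> ennreal (1 + 2 ^ Suc k) * l"
      using maximal_rearrangement_bound_of_orlicz[of F \<tau> f, OF assms \<tau> mem[of \<tau>, OF \<tau>]] by metis
    obtain r where r: "l = ennreal r" "0 < r" using l by (cases l) auto
    \<comment> \<open>The points were chosen to exceed \<open>k\<close> times the constant, so any index beyond \<open>r\<close> contradicts.\<close>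
    obtain k :: nat where "r \<le> real k" using real_arch_simple by blast
    have "ennreal (real k * (1 + 2 ^ Suc k)) < ennreal (1 + 2 ^ Suc k) * l"
      using large[of k] small[of k] by (rule order_less_le_trans)
    also have "\<dots> = ennreal ((1 + 2 ^ Suc k) * r)"
      unfolding r(1) by (simp add: ennreal_mult' del: ennreal_plus power_Suc)
    also have "\<dots> \<le> ennreal (real k * (1 + 2 ^ Suc k))"
      using \<open>r \<le> real k\<close> by (subst mult.commute) (intro ennreal_leI mult_right_mono, auto)
    finally show False by simp
  qed
  with meas show "f \<in> weak_orlicz_space F"
    by (simp add: weak_orlicz_space_def finite_norm_space_def)
qed

end
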